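(* Let $i\in\{1,2\}$, $N\ge2$ and $2\le k\le N$. Let $R_j^{(i)}(\theta)$, $g_j^{(i)}$, $h_j^{(i)}(\theta)$, $\Gamma_k^{(i)}(\theta)$, the algebra $\mathcal A=\mathbb{C}[\theta,z,z^{-1}]$ and the operators $\mathcal M$ and $\mathcal I$ be as defined in the context. Let $\widetilde P_k^{(i)}(\theta,z)\in\mathcal A$ be the algebraic representation of $\Gamma_k^{(i)}(\theta)$. Then the normal-form coefficient $g_k^{(i)}$ is given by $$g_k^{(i)}=\mathcal M\big[\widetilde P_k^{(i)}\big],$$ and the algebraic representation $\widehat h_k^{(i)}(\theta,z)\in\mathcal A$ of the transformation function $h_k^{(i)}(\theta)$ is $$\widehat h_k^{(i)}(\theta,z)=\mathcal I\big[\widetilde P_k^{(i)}(\theta,z)-g_k^{(i)}\big].$$ Consequently, $h_k^{(i)}(\theta)=\widehat h_k^{(i)}(\theta,e^{\mathrm i\theta})$ and $h_k^{(i)}(0)=h_k^{(i)}(\pi)=0$.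
   Context: For $i=1,2$ consider on the half-plane $y\ge0$ a system $\dot x=-y+P^{(i)}(x,y)$, $\dot y=x+Q^{(i)}(x,y)$, where $P^{(i)}=\sum_{j\ge2}P_j^{(i)}$, $Q^{(i)}=\sum_{j\ge2}Q_j^{(i)}$ are convergent series with $P_j^{(i)},Q_j^{(i)}$ homogeneous polynomials of degree $j$. In polar coordinates $x=r\cos\theta$, $y=r\sin\theta$ it becomes $$\frac{dr}{d\theta}=\sum_{j\ge2}R_j^{(i)}(\theta)r^j\qquad(\ast)$$ near $r=0$, where the $R_j^{(i)}$ are trigonometric polynomials in $\theta$. Normal form: a near-identity transformation $r=\rho+\sum_{j=2}^N h_j^{(i)}(\theta)\rho^j$ with $h_j^{(i)}(0)=h_j^{(i)}(\pi)=0$ is fixed which transforms $(\ast)$, for $\theta\in[0,\pi]$, into $\frac{d\rho}{d\theta}=\sum_{j=2}^N g_j^{(i)}\rho^j+O(\rho^{N+1})$ with constants $g_j^{(i)}$ (such a transformation is known to exist). Put $\mathcal H_{<k}^{(i)}(\theta,\rho)=\sum_{\ell=2}^{k-1}h_\ell^{(i)}(\theta)\rho^\ell$, $G_{<k}^{(i)}(\rho)=\sum_{m=2}^{k-1}g_m^{(i)}\rho^m$, and $$\Gamma_k^{(i)}(\theta)=[\rho^k]\Big\{\sum_{j=2}^kR_j^{(i)}(\theta)\big(\rho+\mathcal H_{<k}^{(i)}(\theta,\rho)\big)^j-\frac{\partial\mathcal H_{<k}^{(i)}(\theta,\rho)}{\partial\rho}G_{<k}^{(i)}(\rho)\Big\},$$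 where $[\rho^k]$ denotes the coefficient of $\rho^k$. Algebra: $\mathcal A=\mathbb{C}[\theta,z,z^{-1}]$, with $z$ standing for $e^{\mathrm i\theta}$. An element $F(\theta,z)\in\mathcal A$ is the algebraic representation of a function $f(\theta)$ if $f(\theta)=F(\theta,e^{\mathrm i\theta})$ for all $\theta$. Operators: for $F=\sum_{p=0}^P\sum_{j=m}^n c_{p,j}\theta^pz^j\in\mathcal A$, $$\mathcal M[F]=\sum_{p,j}c_{p,j}\mu_{p,j},\quad \mu_{p,0}=\frac{\pi^p}{p+1},$$ and for $j\ne0$: $\mu_{0,j}=\frac{(-1)^j-1}{j\mathrm i\pi}$, $\mu_{p,j}=\frac{(-1)^j\pi^{p-1}}{j\mathrm i}-\frac{p}{j\mathrm i}\mu_{p-1,j}$ for $p\ge1$. $\mathcal I:\mathcal A\to\mathcal A$ is the linear operator with $\mathcal I[\theta^p]=\frac{\theta^{p+1}}{p+1}$ and, for $j\neq0$, $$\mathcal I[\theta^pz^j]=z^j\sum_{q=0}^p\frac{(-1)^qp!}{(p-q)!(j\mathrm i)^{q+1}}\theta^{p-q}-\frac{(-1)^pp!}{(j\mathrm i)^{p+1}}.$$ *)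

theory Defs
  imports
    "HOL-Analysis.Analysis"
    "HOL-Computational_Algebra.Polynomial"
    "HOL-Library.Poly_Mapping"
begin

definition homogeneous_poly :: "nat \<Rightarrow> (real \<Rightarrow> real \<Rightarrow> real) \<Rightarrow> bool" where
  "homogeneous_poly n f \<longleftrightarrow>
     (\<exists>c. \<forall>x y. f x y = (\<Sum>a\<le>n. c a * x ^ a * y ^ (n - a)))"

text \<open>
  Convergence is required pointwise on a half-disc about the origin in the half-plane
  \<open>y \<ge> 0\<close>. Because the terms are homogeneous, this already forces convergence of
  the full double power series near the origin.
\<close>

definition convergent_series :: "(nat \<Rightarrow> real \<Rightarrow> real \<Rightarrow> real) \<Rightarrow> bool" where
  "convergent_series P \<longleftrightarrow>
     (\<forall>j\<ge>2. homogeneous_poly j (P j)) \<and>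
     (\<exists>\<delta>>0. \<forall>x y. y \<ge> 0 \<and> norm (x, y) < \<delta> \<longrightarrow> (\<lambda>j. P j x y) summable_on {2..})"

definition xdot :: "(nat \<Rightarrow> real \<Rightarrow> real \<Rightarrow> real) \<Rightarrow> real \<Rightarrow> real \<Rightarrow> real" where
  "xdot P x y = - y + (\<Sum>\<^sub>\<infinity>j\<in>{2..}. P j x y)"

definition ydot :: "(nat \<Rightarrow> real \<Rightarrow> real \<Rightarrow> real) \<Rightarrow> real \<Rightarrow> real \<Rightarrow> real" where
  "ydot Q x y = x + (\<Sum>\<^sub>\<infinity>j\<in>{2..}. Q j x y)"

text \<open>
  With \<open>x = r cos \<theta>\<close> and \<open>y = r sin \<theta>\<close> one has
  \<open>r' = cos \<theta> x' + sin \<theta> y'\<close> and \<open>r \<theta>' = cos \<theta> y' - sin \<theta> x'\<close>.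
\<close>

definition rdot where
  "rdot P Q \<theta> r =
     cos \<theta> * xdot P (r * cos \<theta>) (r * sin \<theta>) + sin \<theta> * ydot Q (r * cos \<theta>) (r * sin \<theta>)"

definition thetadot where
  "thetadot P Q \<theta> r =
     (cos \<theta> * ydot Q (r * cos \<theta>) (r * sin \<theta>) - sin \<theta> * xdot P (r * cos \<theta>) (r * sin \<theta>)) / r"

definition trig_poly :: "(real \<Rightarrow> real) \<Rightarrow> bool" where
  "trig_poly f \<longleftrightarrow>
     (\<exists>n a b. \<forall>\<theta>. f \<theta> = (\<Sum>m\<le>n. a m * cos (real m * \<theta>) + b m * sin (real m * \<theta>)))"

text \<open>
  The half-plane corresponds to \<open>\<theta> \<in> [0, \<pi>]\<close>. The expansion determines every
  \<open>R j\<close> with \<open>j \<ge> 2\<close> uniquely on \<open>[0, \<pi>]\<close>, and hence everywhere, as a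
  trigonometric polynomial.
\<close>

definition polar_form ::
  "(nat \<Rightarrow> real \<Rightarrow> real \<Rightarrow> real) \<Rightarrow> (nat \<Rightarrow> real \<Rightarrow> real \<Rightarrow> real) \<Rightarrow> (nat \<Rightarrow> real \<Rightarrow> real) \<Rightarrow> bool" where
  "polar_form P Q R \<longleftrightarrow>
     (\<forall>j\<ge>2. trig_poly (R j)) \<and>
     (\<exists>\<delta>>0. \<forall>\<theta>\<in>{0..pi}. \<forall>r\<in>{0<..<\<delta>}.
        ((\<lambda>j. R j \<theta> * r ^ j) has_sum (rdot P Q \<theta> r / thetadot P Q \<theta> r)) {2..})"

text \<open>\<open>H_less h k \<theta>\<close> and \<open>G_less g k\<close> are polynomials in \<open>\<rho>\<close>.\<close>

definition H_less :: "(nat \<Rightarrow> real \<Rightarrow> real) \<Rightarrow> nat \<Rightarrow> real \<Rightarrow> real poly" where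
  "H_less h k \<theta> = (\<Sum>l\<in>{2..<k}. monom (h l \<theta>) l)"

definition G_less :: "(nat \<Rightarrow> real) \<Rightarrow> nat \<Rightarrow> real poly" where
  "G_less g k = (\<Sum>m\<in>{2..<k}. monom (g m) m)"

text \<open>
  Substituting \<open>r = \<rho> + H(\<theta>, \<rho>)\<close>, with \<open>H = H_less h (Suc N)\<close>, into
  \<open>dr/d\<theta> = (\<Sum>j\<ge>2. R j \<theta> * r ^ j)\<close> gives
  \<open>(1 + \<partial>H/\<partial>\<rho>) d\<rho>/d\<theta> + \<partial>H/\<partial>\<theta> = (\<Sum>j\<ge>2. R j \<theta> * (\<rho> + H) ^ j)\<close>.
  The function below is this equation solved for \<open>d\<rho>/d\<theta>\<close>.
\<close>

definition transformed_rhs ::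
  "nat \<Rightarrow> (nat \<Rightarrow> real \<Rightarrow> real) \<Rightarrow> (nat \<Rightarrow> real \<Rightarrow> real) \<Rightarrow> real \<Rightarrow> real \<Rightarrow> real" where
  "transformed_rhs N R h \<theta> \<rho> =
     ((\<Sum>\<^sub>\<infinity>j\<in>{2..}. R j \<theta> * (\<rho> + poly (H_less h (Suc N) \<theta>) \<rho>) ^ j)
        - vector_derivative (\<lambda>t. poly (H_less h (Suc N) t) \<rho>) (at \<theta> within {0..pi}))
     / (1 + poly (pderiv (H_less h (Suc N) \<theta>)) \<rho>)"

text \<open>The remainder \<open>O(\<rho> ^ (N + 1))\<close> is uniform in \<open>\<theta> \<in> [0, \<pi>]\<close>.\<close>

definition normal_form ::
  "nat \<Rightarrow> (nat \<Rightarrow> real \<Rightarrow> real) \<Rightarrow> (nat \<Rightarrow> real \<Rightarrow> real) \<Rightarrow> (nat \<Rightarrow> real) \<Rightarrow> bool" where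
  "normal_form N R h g \<longleftrightarrow>
     (\<forall>j\<in>{2..N}. h j differentiable_on {0..pi} \<and> h j 0 = 0 \<and> h j pi = 0) \<and>
     (\<exists>C. \<exists>\<delta>>0. \<forall>\<theta>\<in>{0..pi}. \<forall>\<rho>\<in>{0<..<\<delta>}.
        \<bar>transformed_rhs N R h \<theta> \<rho> - (\<Sum>j=2..N. g j * \<rho> ^ j)\<bar> \<le> C * \<rho> ^ (N + 1))"

definition Gamma_nf ::
  "(nat \<Rightarrow> real \<Rightarrow> real) \<Rightarrow> (nat \<Rightarrow> real \<Rightarrow> real) \<Rightarrow> (nat \<Rightarrow> real) \<Rightarrow> nat \<Rightarrow> real \<Rightarrow> real" where
  "Gamma_nf R h g k \<theta> =
     coeff ((\<Sum>j=2..k. smult (R j \<theta>) ((monom 1 1 + H_less h k \<theta>) ^ j))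
              - pderiv (H_less h k \<theta>) * G_less g k) k"

text \<open>
  \<open>Poly_Mapping.single (p, j) c\<close> is the monomial \<open>c \<theta>^p z^j\<close>; the convolution product
  of finitely supported maps on the monoid \<open>nat \<times> int\<close> is multiplication in
  \<open>\<complex>[\<theta>, z, z\<^sup>-\<^sup>1]\<close>.
\<close>

type_synonym alg = "(nat \<times> int) \<Rightarrow>\<^sub>0 complex"

definition alg_eval :: "alg \<Rightarrow> complex \<Rightarrow> complex \<Rightarrow> complex" where
  "alg_eval F t z =
     (\<Sum>(p, j)\<in>Poly_Mapping.keys F. Poly_Mapping.lookup F (p, j) * t ^ p * z powi j)"

text \<open>The functions represented here live on \<open>[0, \<pi>]\<close>.\<close>

definition alg_rep :: "alg \<Rightarrow> (real \<Rightarrow> complex) \<Rightarrow> bool" where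
  "alg_rep F f \<longleftrightarrow>
     (\<forall>\<theta>\<in>{0..pi}. f \<theta> = alg_eval F (of_real \<theta>) (exp (\<i> * of_real \<theta>)))"

fun mu :: "nat \<Rightarrow> int \<Rightarrow> complex" where
  "mu 0 j =
     (if j = 0 then 1 else ((-1) powi j - 1) / (of_int j * \<i> * of_real pi))"
| "mu (Suc p) j =
     (if j = 0 then of_real pi ^ Suc p / of_nat (Suc p + 1)
      else (-1) powi j * of_real pi ^ p / (of_int j * \<i>) - of_nat (Suc p) / (of_int j * \<i>) * mu p j)"

definition M_op :: "alg \<Rightarrow> complex" where
  "M_op F = (\<Sum>(p, j)\<in>Poly_Mapping.keys F. Poly_Mapping.lookup F (p, j) * mu p j)"

definition I_monom :: "nat \<Rightarrow> int \<Rightarrow> alg" where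
  "I_monom p j =
     (if j = 0 then Poly_Mapping.single (p + 1, 0) (1 / of_nat (p + 1))
      else (\<Sum>q\<le>p. Poly_Mapping.single (p - q, j)
                      ((-1) ^ q * fact p / (fact (p - q) * (of_int j * \<i>) ^ (q + 1))))
           - Poly_Mapping.single (0, 0) ((-1) ^ p * fact p / (of_int j * \<i>) ^ (p + 1)))"

text \<open>Linear extension; \<open>alg_const c * F\<close> is scalar multiplication by \<open>c\<close>.\<close>

definition alg_const :: "complex \<Rightarrow> alg" where
  "alg_const c = Poly_Mapping.single (0, 0) c"

definition I_op :: "alg \<Rightarrow> alg" where
  "I_op F = (\<Sum>(p, j)\<in>Poly_Mapping.keys F. alg_const (Poly_Mapping.lookup F (p, j)) * I_monom p j)"

end

theory Submission
  imports Defs "HOL-Complex_Analysis.Conformal_Mappings" "HOL-Library.Landau_Symbols"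
begin

text \<open>
  Comparing the coefficients of \<open>\<rho>\<^sup>k\<close> in the transformed equation at a fixed \<open>\<theta>\<close> gives the
  homological equation \<open>h\<^sub>k' = \<Gamma>\<^sub>k - g\<^sub>k\<close> on \<open>[0, \<pi>]\<close>. By integration by parts, \<open>\<I>[F]\<close> represents the
  antiderivative of \<open>F\<close> that vanishes at \<open>0\<close>, and its value at \<open>\<pi>\<close> is \<open>\<pi> \<M>[F]\<close>. Hence
  \<open>h\<^sub>k = \<I>[P - g\<^sub>k]\<close>, and \<open>h\<^sub>k(\<pi>) = 0\<close> becomes \<open>\<M>[P] = g\<^sub>k\<close>. Representations are unique because
  \<open>t\<close> and \<open>e\<^bsup>\<i>t\<^esup>\<close> are algebraically independent.
\<close>

subsection \<open>The operators on the algebra\<close>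

text \<open>Both \<open>M_op\<close> and evaluation at a point are extensions of this kind from
  monomials, so their linearity is proved once.\<close>

definition lin_ext :: "('k \<Rightarrow> 'b) \<Rightarrow> ('k \<Rightarrow>\<^sub>0 'b) \<Rightarrow> 'b::comm_ring_1" where
  "lin_ext w F = (\<Sum>x\<in>Poly_Mapping.keys F. Poly_Mapping.lookup F x * w x)"

text \<open>Cancellation makes the keys of a sum or a multiple hard to predict; a common finite
  index set avoids computing them.\<close>

lemma lin_ext_superset:
  assumes "finite S" "Poly_Mapping.keys F \<subseteq> S"
  shows "lin_ext w F = (\<Sum>x\<in>S. Poly_Mapping.lookup F x * w x)"
  unfolding lin_ext_def
  by (rule sum.mono_neutral_left) (use assms in \<open>auto simp: in_keys_iff\<close>)

lemma lin_ext_add: "lin_ext w (F + G) = lin_ext w F + lin_ext w G"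
proof -
  let ?S = "Poly_Mapping.keys F \<union> Poly_Mapping.keys G"
  have "Poly_Mapping.keys (F + G) \<subseteq> ?S"
    by (rule keys_add)
  then show ?thesis
    by (simp add: lin_ext_superset[of ?S] lookup_add distrib_right sum.distrib)
qed

lemma lin_ext_zero [simp]: "lin_ext w 0 = 0"
  by (simp add: lin_ext_def)

lemma lin_ext_uminus: "lin_ext w (- F) = - lin_ext w F"
  by (metis lin_ext_add lin_ext_zero add.right_inverse add_eq_0_iff)

lemma lin_ext_diff: "lin_ext w (F - G) = lin_ext w F - lin_ext w G"
  by (metis lin_ext_add lin_ext_uminus diff_conv_add_uminus)

lemma lin_ext_sum: "lin_ext w (\<Sum>x\<in>A. F x) = (\<Sum>x\<in>A. lin_ext w (F x))"
  by (induction A rule: infinite_finite_induct) (auto simp: lin_ext_add)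

lemma lin_ext_single [simp]: "lin_ext w (Poly_Mapping.single x c) = c * w x"
  by (simp add: lin_ext_def)

lemma lin_ext_const_mult: "lin_ext w (alg_const c * F) = c * lin_ext w F"
proof -
  \<comment> \<open>\<open>alg_const c\<close> sits at the neutral exponent \<open>(0, 0)\<close>,
    so convolution with it only rescales coefficients.\<close>
  have "alg_const c * F = Poly_Mapping.map ((*) c) F"
    by (simp add: alg_const_def mult_map_scale_conv_mult zero_prod_def)
  moreover have "Poly_Mapping.keys (Poly_Mapping.map ((*) c) F) \<subseteq> Poly_Mapping.keys F"
    by (auto simp: in_keys_iff map.rep_eq when_def)
  moreover have "Poly_Mapping.lookup (Poly_Mapping.map ((*) c) F) x = c * Poly_Mapping.lookup F x" for x
    by (simp add: map.rep_eq when_def)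
  ultimately show ?thesis
    by (simp add: lin_ext_superset[of "Poly_Mapping.keys F"] sum_distrib_left mult.assoc)
qed

lemma M_op_eq_lin_ext: "M_op = lin_ext (\<lambda>(p, j). mu p j)"
  by (auto simp: fun_eq_iff M_op_def lin_ext_def intro!: sum.cong)

lemma alg_eval_eq_lin_ext: "alg_eval F t z = lin_ext (\<lambda>(p, j). t ^ p * z powi j) F"
  by (auto simp: alg_eval_def lin_ext_def mult.assoc intro!: sum.cong)

lemma alg_eval_linear:
  "alg_eval (F - G) t z = alg_eval F t z - alg_eval G t z"
  "alg_eval (\<Sum>x\<in>A. f x) t z = (\<Sum>x\<in>A. alg_eval (f x) t z)"
  "alg_eval (alg_const c * F) t z = c * alg_eval F t z"
  by (simp_all add: alg_eval_eq_lin_ext lin_ext_diff lin_ext_sum lin_ext_const_mult)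

lemma alg_eval_single [simp]:
  "alg_eval (Poly_Mapping.single (p, j) c) t z = c * t ^ p * z powi j"
  by (simp add: alg_eval_eq_lin_ext mult.assoc)

lemma alg_eval_const [simp]: "alg_eval (alg_const c) t z = c"
  by (simp add: alg_const_def)

text \<open>Evaluation turns \<open>I_op\<close> into a scalar linear extension, which reduces its
  derivative and its boundary values to single monomials.\<close>

lemma alg_eval_I_op:
  "alg_eval (I_op F) t z = lin_ext (\<lambda>(p, j). alg_eval (I_monom p j) t z) F"
  by (auto simp: I_op_def alg_eval_linear lin_ext_def intro!: sum.cong)

lemma alg_eval_I_monom_0: "alg_eval (I_monom p 0) t z = t ^ (p + 1) / of_nat (p + 1)"
  by (simp add: I_monom_def)

text \<open>Integration by parts.\<close>

lemma alg_eval_I_monom_rec: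
  assumes "j \<noteq> 0"
  shows "alg_eval (I_monom 0 j) t z = (z powi j - 1) / (of_int j * \<i>)"
    and "alg_eval (I_monom (Suc p) j) t z
           = t ^ Suc p * z powi j / (of_int j * \<i>)
             - of_nat (Suc p) / (of_int j * \<i>) * alg_eval (I_monom p j) t z"
proof -
  define w where "w = of_int j * \<i>"
  have w: "w \<noteq> 0"
    using assms by (simp add: w_def)
  have I: "alg_eval (I_monom p j) t z
      = (\<Sum>q\<le>p. (-1) ^ q * fact p / (fact (p - q) * w ^ (q + 1)) * t ^ (p - q) * z powi j)
        - (-1) ^ p * fact p / w ^ (p + 1)" for p
    using assms by (simp add: I_monom_def alg_eval_linear w_def)
  show "alg_eval (I_monom 0 j) t z = (z powi j - 1) / (of_int j * \<i>)"
    using w by (simp add: I diff_divide_distrib flip: w_def)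
  \<comment> \<open>Up to the factor \<open>-(p + 1) / w\<close>, summand \<open>q + 1\<close> for
    the exponent \<open>p + 1\<close> is summand \<open>q\<close> for \<open>p\<close>. The summand
    with index 0 is the boundary term of the integration by parts.\<close>
  have shift: "(-1) ^ Suc q * fact (Suc p) / (fact (p - q) * w ^ (Suc q + 1)) * t ^ (p - q) * z powi j
      = - (of_nat (Suc p) / w)
          * ((-1) ^ q * fact p / (fact (p - q) * w ^ (q + 1)) * t ^ (p - q) * z powi j)" for q
    using w by (simp add: divide_simps)
  have "(\<Sum>q\<le>Suc p. (-1) ^ q * fact (Suc p) / (fact (Suc p - q) * w ^ (q + 1)) * t ^ (Suc p - q) * z powi j)
      = t ^ Suc p * z powi j / w + (\<Sum>q\<le>p. - (of_nat (Suc p) / w)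
          * ((-1) ^ q * fact p / (fact (p - q) * w ^ (q + 1)) * t ^ (p - q) * z powi j))"
    by (subst sum.atMost_Suc_shift) (simp only: shift diff_Suc_Suc, simp del: fact_Suc)
  moreover have "(-1) ^ Suc p * fact (Suc p) / w ^ (Suc p + 1)
      = - (of_nat (Suc p) / w) * ((-1) ^ p * fact p / w ^ (p + 1))"
    using w by (simp add: field_simps)
  ultimately have "alg_eval (I_monom (Suc p) j) t z
      = t ^ Suc p * z powi j / w - of_nat (Suc p) / w * alg_eval (I_monom p j) t z"
    unfolding I sum_distrib_left[symmetric] by (simp only: right_diff_distrib mult_minus_left) simp
  then show "alg_eval (I_monom (Suc p) j) t z
      = t ^ Suc p * z powi j / (of_int j * \<i>)
        - of_nat (Suc p) / (of_int j * \<i>) * alg_eval (I_monom p j) t z"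
    by (simp add: w_def)
qed

text \<open>For \<open>j \<noteq> 0\<close>, induction on \<open>p\<close>: differentiating the
  boundary term gives the wanted integrand and a multiple of the integrand for \<open>p\<close>,
  which the other term of the recursion cancels. Complex \<open>t\<close> is used so that analytic
  rules apply.\<close>

lemma has_field_derivative_alg_eval_I_monom:
  "((\<lambda>t. alg_eval (I_monom p j) t (exp (\<i> * t))) has_field_derivative t ^ p * exp (\<i> * t) powi j) (at t)"
proof (cases "j = 0")
  case True
  show ?thesis
    unfolding True alg_eval_I_monom_0
    by (rule DERIV_cong[OF DERIV_cdivide[OF DERIV_power[OF DERIV_ident]]]) (simp del: of_nat_Suc)
next
  case False
  have z: "((\<lambda>t. exp (\<i> * t) powi j) has_field_derivative of_int j * \<i> * exp (\<i> * t) powi j) (at t)"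
    unfolding exp_power_int by (auto intro!: derivative_eq_intros)
  show ?thesis
  proof (induction p)
    case 0
    show ?case
      unfolding alg_eval_I_monom_rec(1)[OF False]
      by (rule DERIV_cong[OF DERIV_cdivide[OF DERIV_diff[OF z DERIV_const]]]) (use False in simp)
  next
    case (Suc p)
    show ?case
      unfolding alg_eval_I_monom_rec(2)[OF False]
      by (rule DERIV_cong[OF DERIV_diff[OF DERIV_cdivide[OF DERIV_mult[OF DERIV_power[OF DERIV_ident] z]]
              DERIV_cmult[OF Suc]]])
        (simp add: add_divide_distrib algebra_simps, simp add: False)
  qed
qed

text \<open>The constant subtracted in \<open>I_monom\<close> selects the antiderivative that is 0
  at \<open>t = 0\<close>, where \<open>z = exp 0 = 1\<close>.\<close>

lemma alg_eval_I_monom_at_0: "alg_eval (I_monom p j) 0 1 = 0"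
proof (cases "j = 0")
  case False
  then show ?thesis
    by (induction p) (simp_all add: alg_eval_I_monom_rec)
qed (simp add: alg_eval_I_monom_0)

text \<open>The recursion of \<open>mu\<close> is the integration by parts at \<open>t = pi\<close>,
  \<open>z = -1\<close>, divided by \<open>pi\<close>. Thus \<open>mu p j\<close> is the mean of
  \<open>t ^ p * exp (\<i> * j * t)\<close> over \<open>[0, pi]\<close>.\<close>

lemma alg_eval_I_monom_at_pi: "alg_eval (I_monom p j) (of_real pi) (-1) = of_real pi * mu p j"
proof (cases "j = 0")
  case False
  then show ?thesis
    by (induction p) (simp_all add: alg_eval_I_monom_rec field_simps)
next
  case True
  then show ?thesis
    by (cases p) (simp_all add: alg_eval_I_monom_0 field_simps)
qed

lemma has_field_derivative_alg_eval_I_op: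
  "((\<lambda>t. alg_eval (I_op F) t (exp (\<i> * t))) has_field_derivative alg_eval F t (exp (\<i> * t))) (at t)"
  unfolding alg_eval_I_op alg_eval_eq_lin_ext[of F] lin_ext_def
  by (rule DERIV_sum, rule DERIV_cmult, split prod.split)
    (use has_field_derivative_alg_eval_I_monom in auto)

lemma alg_eval_I_op_at_0: "alg_eval (I_op F) 0 1 = 0"
  by (simp add: alg_eval_I_op lin_ext_def alg_eval_I_monom_at_0 case_prod_unfold)

lemma alg_eval_I_op_at_pi: "alg_eval (I_op F) (of_real pi) (-1) = of_real pi * M_op F"
  by (simp add: alg_eval_I_op M_op_eq_lin_ext lin_ext_def alg_eval_I_monom_at_pi case_prod_unfold
      sum_distrib_left mult.left_commute)

lemma M_op_diff_const: "M_op (F - alg_const c) = M_op F - c"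
  by (simp add: M_op_eq_lin_ext lin_ext_diff alg_const_def)

section \<open>Uniqueness of algebraic representations\<close>

text \<open>Multiplying by \<open>z ^ m\<close> clears the negative powers. What remains is a
  polynomial in \<open>t\<close> whose coefficients are polynomials in \<open>z\<close>, so roots
  can be counted in each variable.\<close>

lemma alg_eval_double_sum:
  "\<exists>n m. (\<forall>p j. Poly_Mapping.lookup F (p, j) \<noteq> 0 \<longrightarrow> p \<le> n \<and> \<bar>j\<bar> \<le> int m) \<and>
    (\<forall>t z. z \<noteq> 0 \<longrightarrow> z ^ m * alg_eval F t z
      = (\<Sum>p\<le>n. (\<Sum>l\<le>2*m. Poly_Mapping.lookup F (p, int l - int m) * z ^ l) * t ^ p))"
proof -
  obtain n where n: "\<forall>p\<in>fst ` Poly_Mapping.keys F. p \<le> n"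
    by (meson finite_imageI finite_keys finite_nat_set_iff_bounded_le)
  obtain m where m: "\<forall>l\<in>(\<lambda>x. nat \<bar>snd x\<bar>) ` Poly_Mapping.keys F. l \<le> m"
    by (meson finite_imageI finite_keys finite_nat_set_iff_bounded_le)
  have bound: "p \<le> n \<and> \<bar>j\<bar> \<le> int m" if "Poly_Mapping.lookup F (p, j) \<noteq> 0" for p j
  proof -
    have "(p, j) \<in> Poly_Mapping.keys F"
      using that by (simp add: in_keys_iff)
    then show ?thesis
      using n m by force
  qed
  let ?g = "\<lambda>(p, l). (p, int l - int m)"
  have "z ^ m * alg_eval F t z
      = (\<Sum>p\<le>n. (\<Sum>l\<le>2*m. Poly_Mapping.lookup F (p, int l - int m) * z ^ l) * t ^ p)"
    if z: "z \<noteq> 0" for t z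
  proof -
    have sub: "Poly_Mapping.keys F \<subseteq> ?g ` ({..n} \<times> {..2*m})"
    proof
      fix x assume "x \<in> Poly_Mapping.keys F"
      moreover obtain p j where x: "x = (p, j)"
        by (cases x)
      ultimately have "p \<le> n" "\<bar>j\<bar> \<le> int m"
        using bound by (auto simp: in_keys_iff)
      then have "x = ?g (p, nat (j + int m))" "(p, nat (j + int m)) \<in> {..n} \<times> {..2*m}"
        by (auto simp: x)
      then show "x \<in> ?g ` ({..n} \<times> {..2*m})"
        by blast
    qed
    have pw: "z ^ m * z powi (int l - int m) = z ^ l" for l
      using z by (simp add: power_int_diff)
    have "inj_on ?g ({..n} \<times> {..2*m})"
      by (auto simp: inj_on_def)
    then have "alg_eval F t z
        = (\<Sum>(p, l)\<in>{..n} \<times> {..2*m}.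
             Poly_Mapping.lookup F (p, int l - int m) * (t ^ p * z powi (int l - int m)))"
      unfolding alg_eval_eq_lin_ext
      by (subst lin_ext_superset[OF _ sub]) (simp_all add: sum.reindex case_prod_unfold)
    then have "z ^ m * alg_eval F t z
        = (\<Sum>(p, l)\<in>{..n} \<times> {..2*m}.
             Poly_Mapping.lookup F (p, int l - int m) * t ^ p * (z ^ m * z powi (int l - int m)))"
      by (simp add: sum_distrib_left case_prod_unfold mult_ac)
    then show ?thesis
      by (simp only: pw) (simp add: sum.cartesian_product[symmetric] sum_distrib_right sum_distrib_left mult_ac)
  qed
  with bound show ?thesis
    by blast
qed

text \<open>
  Analytic continuation extends the identity from \<open>[0, \<pi>]\<close> to all complex \<open>t\<close>. The shifts
  \<open>t + 2 \<pi> n\<close> leave \<open>exp (\<i> t)\<close> fixed, so the polynomial in the first variable has infinitely many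
  roots; its coefficients are then Laurent polynomials with infinitely many roots.
\<close>

lemma alg_eval_eq_0_imp_eq_0:
  assumes F0: "\<And>\<theta>. \<theta> \<in> {0..pi} \<Longrightarrow> alg_eval F (of_real \<theta>) (exp (\<i> * of_real \<theta>)) = 0"
  shows "F = 0"
proof -
  let ?f = "\<lambda>t. alg_eval F t (exp (\<i> * t))"
  \<comment> \<open>Writing the powers of \<open>exp (\<i> * t)\<close> as exponentials makes the
    function entire, also for negative exponents.\<close>
  have hol: "?f holomorphic_on UNIV"
    unfolding alg_eval_def case_prod_unfold exp_power_int by (intro holomorphic_intros)
  have lim: "(0::complex) islimpt complex_of_real ` {0..pi}"
  proof (rule islimptI)
    fix T :: "complex set" assume "0 \<in> T" "open T"
    then obtain e where e: "e > 0" "ball 0 e \<subseteq> T"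
      using open_contains_ball by blast
    define x where "x = min (e/2) pi"
    have "complex_of_real x \<in> ball 0 e" "x \<in> {0..pi}" "x \<noteq> 0"
      using e by (auto simp: x_def min_def)
    then show "\<exists>y\<in>complex_of_real ` {0..pi}. y \<in> T \<and> y \<noteq> 0"
      using e by (intro bexI[of _ "of_real x"]) auto
  qed
  have f0: "?f t = 0" for t
    by (rule analytic_continuation[OF hol open_UNIV connected_UNIV, of "complex_of_real ` {0..pi}" 0])
      (use lim F0 in auto)
  obtain n m where F: "\<And>t z. z \<noteq> 0 \<Longrightarrow> z ^ m * alg_eval F t z
      = (\<Sum>p\<le>n. (\<Sum>l\<le>2*m. Poly_Mapping.lookup F (p, int l - int m) * z ^ l) * t ^ p)"
    and bound: "\<And>p j. Poly_Mapping.lookup F (p, j) \<noteq> 0 \<Longrightarrow> p \<le> n \<and> \<bar>j\<bar> \<le> int m"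
    using alg_eval_double_sum[of F] by blast
  have coeff0: "(\<Sum>l\<le>2*m. Poly_Mapping.lookup F (p, int l - int m) * z ^ l) = 0"
    if "p \<le> n" and z: "z \<noteq> 0" for p z
  proof (rule ccontr)
    assume "\<not> ?thesis"
    then have "finite {t. (\<Sum>p\<le>n. (\<Sum>l\<le>2*m. Poly_Mapping.lookup F (p, int l - int m) * z ^ l) * t ^ p) = 0}"
      using that by (subst Transcendental.polyfun_finite_roots) blast
    then have fin: "finite {t. alg_eval F t z = 0}"
      using that by (simp flip: F)
    obtain t where t: "exp (\<i> * t) = z"
    proof
      show "exp (\<i> * (- \<i> * Ln z)) = z"
        using z by (simp flip: mult.assoc)
    qed
    let ?s = "\<lambda>k::nat. t + of_real (2 * pi * real k)"
    have per: "exp (\<i> * ?s k) = z" for k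
    proof -
      have "exp (\<i> * ?s k) = exp (\<i> * t) * exp (of_real (2 * real k * pi) * \<i>)"
        unfolding exp_add[symmetric] by (simp add: algebra_simps)
      also have "exp (of_real (2 * real k * pi) * \<i>) = 1"
        by (rule exp_integer_2pi) simp
      finally show ?thesis
        by (simp add: t)
    qed
    have "range ?s \<subseteq> {t. alg_eval F t z = 0}"
      using f0 per by fastforce
    moreover have "inj ?s"
      by (auto simp: inj_def)
    ultimately show False
      using fin finite_subset range_inj_infinite by blast
  qed
  have "Poly_Mapping.lookup F (p, j) = 0" for p j
  proof (rule ccontr)
    assume nz: "Poly_Mapping.lookup F (p, j) \<noteq> 0"
    then have "p \<le> n" "\<bar>j\<bar> \<le> int m"
      using bound by auto
    then have "finite {z. (\<Sum>l\<le>2*m. Poly_Mapping.lookup F (p, int l - int m) * z ^ l) = 0}"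
      \<comment> \<open>The coefficient of \<open>z powi j\<close> has been shifted to the index
        \<open>j + m\<close>, which is nonnegative by the bound on \<open>j\<close>.\<close>
      using nz by (subst Transcendental.polyfun_finite_roots) (intro exI[of _ "nat (j + int m)"], auto)
    moreover have "UNIV - {0} \<subseteq> {z. (\<Sum>l\<le>2*m. Poly_Mapping.lookup F (p, int l - int m) * z ^ l) = 0}"
      using coeff0[OF \<open>p \<le> n\<close>] by blast
    ultimately have "finite (UNIV - {0::complex})"
      by (rule finite_subset[rotated])
    then show False
      by (simp add: infinite_UNIV_char_0)
  qed
  then show ?thesis
    by (auto intro: poly_mapping_eqI)
qed

text \<open>The difference of two representations of one function represents 0. This yields the
  equivalence in the theorem.\<close>

lemma alg_rep_unique:
  assumes "alg_rep F f" "alg_rep G f"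
  shows "F = G"
proof -
  have "F - G = 0"
    by (rule alg_eval_eq_0_imp_eq_0) (use assms in \<open>auto simp: alg_rep_def alg_eval_linear\<close>)
  then show ?thesis
    by simp
qed

subsection \<open>The homological equation\<close>

lemma poly_eq_power_mult_poly_shift:
  fixes p :: "'a::comm_ring_1 poly"
  assumes "\<And>i. i < n \<Longrightarrow> coeff p i = 0"
  shows "poly p x = x ^ n * poly (poly_shift n p) x"
proof -
  have "p = monom 1 n * poly_shift n p"
    by (rule poly_eqI) (use assms in \<open>auto simp: coeff_monom_mult coeff_poly_shift\<close>)
  then have "poly p x = poly (monom 1 n * poly_shift n p) x"
    by (rule arg_cong)
  then show ?thesis
    by (simp add: poly_monom)
qed

lemma poly_bigo_power:
  fixes p :: "real poly"
  assumes "\<And>i. i < n \<Longrightarrow> coeff p i = 0"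
  shows "poly p \<in> O[at_right 0](\<lambda>x. x ^ n)"
proof -
  have "poly p = (\<lambda>x. x ^ n * poly (poly_shift n p) x)"
    using assms by (intro ext poly_eq_power_mult_poly_shift)
  moreover have "(poly (poly_shift n p) \<longlongrightarrow> poly (poly_shift n p) 0) (at_right 0)"
    by (rule tendsto_intros)+
  then have "poly (poly_shift n p) \<in> O[at_right 0](\<lambda>_. 1)"
    by (intro bigoI_tendsto[where c = "poly (poly_shift n p) 0"]) auto
  ultimately show ?thesis
    using landau_o.big.mult_left[of "poly (poly_shift n p)" "at_right 0" "\<lambda>_. 1" "\<lambda>x. x ^ n"] by simp
qed

text \<open>Once the coefficients below \<open>k\<close> vanish, \<open>p = x ^ k * q\<close>.
  Dividing the estimate by \<open>x ^ k\<close> leaves a bound that tends to 0 because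
  \<open>k \<le> n\<close>, so \<open>q\<close> is 0 at 0, and this value is coefficient
  \<open>k\<close> of \<open>p\<close>.\<close>

lemma poly_bigo_at_right_0_imp_coeff_eq_0:
  fixes p :: "real poly"
  assumes p: "poly p \<in> O[at_right 0](\<lambda>x. x ^ Suc n)" and "k \<le> n"
  shows "coeff p k = 0"
  using \<open>k \<le> n\<close>
proof (induction k rule: less_induct)
  case (less k)
  define q where "q = poly_shift k p"
  have eq: "poly p x = x ^ k * poly q x" for x
    unfolding q_def by (rule poly_eq_power_mult_poly_shift) (use less in simp)
  obtain c where c: "\<forall>\<^sub>F x in at_right 0. norm (poly p x) \<le> c * norm (x ^ Suc n)"
    using p by (rule landau_o.bigE)
  have "\<forall>\<^sub>F x::real in at_right 0. norm (poly q x) \<le> c * x ^ (Suc n - k)"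
    using c eventually_at_right_less
  proof eventually_elim
    case (elim x)
    have "x ^ Suc n = x ^ k * x ^ (Suc n - k)"
      using less.prems by (simp flip: power_add)
    then have "x ^ k * norm (poly q x) \<le> x ^ k * (c * x ^ (Suc n - k))"
      using elim by (simp add: eq abs_mult mult_ac)
    then show ?case
      using elim by (simp add: mult_le_cancel_left_pos)
  qed
  moreover have "((\<lambda>x. c * x ^ (Suc n - k)) \<longlongrightarrow> 0) (at_right 0)"
    by (rule tendsto_eq_intros refl)+ (use less.prems in \<open>auto simp: power_0_left\<close>)
  ultimately have "(poly q \<longlongrightarrow> 0) (at_right 0)"
    by (rule Lim_null_comparison)
  moreover have "(poly q \<longlongrightarrow> poly q 0) (at_right 0)"
    by (rule tendsto_intros)+
  ultimately have "poly q 0 = 0"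
    by (metis tendsto_unique trivial_limit_at_right_real)
  then show ?case
    by (simp add: q_def poly_0_coeff_0 coeff_poly_shift)
qed

text \<open>For \<open>0 < r < s\<close> each term of index above \<open>n\<close> is at most
  \<open>(r / s) ^ Suc n\<close> times its size at \<open>s\<close>, so the absolute tail sum at
  \<open>s\<close> supplies the constant.\<close>

lemma power_series_tail_bigo:
  fixes a :: "nat \<Rightarrow> real"
  assumes "s > 0" and summable: "(\<lambda>j. a j * s ^ j) summable_on {m..}"
  shows "(\<lambda>r. (\<Sum>\<^sub>\<infinity>j\<in>{m..}. a j * r ^ j) - (\<Sum>j=m..n. a j * r ^ j)) \<in> O[at_right 0](\<lambda>r. r ^ Suc n)"
proof (rule bigoI)
  define T where "T = {m..} - {m..n}"
  define S where "S = (\<Sum>\<^sub>\<infinity>j\<in>T. norm (a j * s ^ j))"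
  have T: "T \<subseteq> {m..}" "{m..} = {m..n} \<union> T" "{m..n} \<inter> T = {}"
    by (auto simp: T_def)
  have "(\<lambda>j. norm (a j * s ^ j)) summable_on {m..}"
    using summable by (rule summable_on_iff_abs_summable_on_real[THEN iffD1])
  then have abs: "(\<lambda>j. norm (a j * s ^ j)) summable_on T"
    using T(1) by (rule summable_on_subset_banach)
  have "\<forall>\<^sub>F r in at_right 0. r < s"
    using eventually_at_right_real[OF \<open>s > 0\<close>] by eventually_elim simp
  then show "\<forall>\<^sub>F r in at_right 0.
      norm ((\<Sum>\<^sub>\<infinity>j\<in>{m..}. a j * r ^ j) - (\<Sum>j=m..n. a j * r ^ j)) \<le> S / s ^ Suc n * norm (r ^ Suc n)"
    using eventually_at_right_less
  proof eventually_elim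
    case (elim r)
    have le: "norm (a j * r ^ j) \<le> (r / s) ^ Suc n * norm (a j * s ^ j)" if "j \<in> T" for j
    proof -
      have "Suc n \<le> j"
        using that by (auto simp: T_def)
      then have "(r / s) ^ j \<le> (r / s) ^ Suc n"
        using elim by (intro power_decreasing) auto
      moreover have "norm (a j * r ^ j) = (r / s) ^ j * norm (a j * s ^ j)"
        using elim \<open>s > 0\<close> by (simp add: abs_mult power_divide)
      ultimately show ?thesis
        by (simp only: mult_right_mono norm_ge_zero)
    qed
    have bound: "(\<lambda>j. (r / s) ^ Suc n * norm (a j * s ^ j)) summable_on T"
      using abs by (rule summable_on_cmult_right)
    then have abs_r: "(\<lambda>j. norm (a j * r ^ j)) summable_on T"
      using le by (rule Infinite_Sum.abs_summable_on_comparison_test')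
    then have "(\<lambda>j. a j * r ^ j) summable_on T"
      by (rule summable_on_iff_abs_summable_on_real[THEN iffD2])
    then have "(\<Sum>\<^sub>\<infinity>j\<in>{m..}. a j * r ^ j) - (\<Sum>j=m..n. a j * r ^ j) = (\<Sum>\<^sub>\<infinity>j\<in>T. a j * r ^ j)"
      unfolding T(2) by (subst infsum_Un_disjoint) (use T(3) in auto)
    then have "norm ((\<Sum>\<^sub>\<infinity>j\<in>{m..}. a j * r ^ j) - (\<Sum>j=m..n. a j * r ^ j))
        \<le> (\<Sum>\<^sub>\<infinity>j\<in>T. norm (a j * r ^ j))"
      using norm_infsum_bound[OF abs_r] by simp
    also have "\<dots> \<le> (\<Sum>\<^sub>\<infinity>j\<in>T. (r / s) ^ Suc n * norm (a j * s ^ j))"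
      using abs_r bound le by (rule infsum_mono)
    also have "\<dots> = (r / s) ^ Suc n * S"
      unfolding S_def using abs by (intro infsum_cmult_right) auto
    finally show ?case
      using elim by (simp add: power_divide mult.commute)
  qed
qed

section \<open>Independence of \<open>Gamma_nf\<close> from the order of truncation\<close>

lemma coeff_power_eq_0:
  fixes p :: "'a::comm_ring_1 poly"
  assumes "coeff p 0 = 0" "k < j"
  shows "coeff (p ^ j) k = 0"
  using assms(2)
proof (induction j arbitrary: k)
  case (Suc j)
  have "coeff p i * coeff (p ^ j) (k - i) = 0" if "i \<le> k" for i
    using Suc that assms(1) by (cases "i = 0") auto
  then show ?case
    by (simp add: coeff_mult)
qed simp

text \<open>Using coefficient \<open>k\<close> of one factor would force a constant term from the
  other \<open>j - 1 \<ge> 1\<close> factors, and these are 0. So only coefficients below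
  \<open>k\<close> enter.\<close>

lemma coeff_power_cong:
  fixes p q :: "'a::comm_ring_1 poly"
  assumes p0: "coeff p 0 = 0" and q0: "coeff q 0 = 0" and "j \<ge> 2"
    and eq: "\<And>i. i < k \<Longrightarrow> coeff p i = coeff q i"
  shows "coeff (p ^ j) k = coeff (q ^ j) k"
proof -
  \<comment> \<open>The induction passes through exponent 1, where agreement holds only strictly
    below \<open>k\<close>; hence the disjunction.\<close>
  have "k' \<le> k \<Longrightarrow> k' < k \<or> j \<ge> 2 \<Longrightarrow> j \<ge> 1 \<Longrightarrow> coeff (p ^ j) k' = coeff (q ^ j) k'" for k'
  proof (induction j arbitrary: k')
    case (Suc j)
    show ?case
    proof (cases "j = 0")
      case True
      then show ?thesis
        using Suc eq by auto
    next
      case False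
      have "coeff p i * coeff (p ^ j) (k' - i) = coeff q i * coeff (q ^ j) (k' - i)" if i: "i \<le> k'" for i
      proof -
        consider "i = 0" | "i = k'" "i > 0" | "0 < i" "i < k'"
          using i by linarith
        then show ?thesis
        proof cases
          case 2
          then show ?thesis
            using False coeff_power_eq_0[OF p0, of 0 j] coeff_power_eq_0[OF q0, of 0 j] by simp
        next
          case 3
          then have "coeff (p ^ j) (k' - i) = coeff (q ^ j) (k' - i)"
            using Suc.prems False by (intro Suc.IH) linarith+
          then show ?thesis
            using 3 eq Suc.prems by simp
        qed (simp add: p0 q0)
      qed
      then show ?thesis
        by (simp add: coeff_mult)
    qed
  qed simp
  then show ?thesis
    using \<open>j \<ge> 2\<close> by auto
qed

lemma coeff_H_less: "coeff (H_less h n \<theta>) l = (if 2 \<le> l \<and> l < n then h l \<theta> else 0)"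
proof -
  have "coeff (H_less h n \<theta>) l = (\<Sum>i\<in>{2..<n}. if i = l then h i \<theta> else 0)"
    by (simp add: H_less_def coeff_sum)
  then show ?thesis
    by (simp add: sum.delta)
qed

lemma coeff_G_less: "coeff (G_less g n) l = (if 2 \<le> l \<and> l < n then g l else 0)"
proof -
  have "coeff (G_less g n) l = (\<Sum>i\<in>{2..<n}. if i = l then g i else 0)"
    by (simp add: G_less_def coeff_sum)
  then show ?thesis
    by (simp add: sum.delta)
qed

text \<open>One truncation at \<open>N + 1\<close> then serves every \<open>k\<close>. Powers with
  \<open>j > k\<close> start above degree \<open>k\<close>; in the product, \<open>pderiv H\<close>
  starts in degree 1 and \<open>G\<close> in degree 2, so only \<open>h l\<close> and
  \<open>g m\<close> with \<open>l, m < k\<close> reach degree \<open>k\<close>.\<close>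

lemma Gamma_nf_eq_coeff:
  assumes "2 \<le> k" "k \<le> N"
  shows "Gamma_nf R h g k \<theta> =
    coeff ((\<Sum>j=2..N. smult (R j \<theta>) ((monom 1 1 + H_less h (Suc N) \<theta>) ^ j))
              - pderiv (H_less h (Suc N) \<theta>) * G_less g (Suc N)) k"
proof -
  let ?p = "\<lambda>n. monom 1 1 + H_less h n \<theta>"
  have p0: "coeff (?p n) 0 = 0" for n
    by (simp add: coeff_H_less)
  have "coeff (?p k ^ j) k = coeff (?p (Suc N) ^ j) k" if "j \<ge> 2" for j
    by (rule coeff_power_cong[OF p0 p0 that]) (use assms in \<open>auto simp: coeff_H_less\<close>)
  moreover have "(\<Sum>j=2..N. R j \<theta> * coeff (?p (Suc N) ^ j) k) = (\<Sum>j=2..k. R j \<theta> * coeff (?p (Suc N) ^ j) k)"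
    by (rule sum.mono_neutral_right) (use assms coeff_power_eq_0[OF p0] in auto)
  moreover have "coeff (pderiv (H_less h (Suc N) \<theta>)) i * coeff (G_less g (Suc N)) (k - i)
      = coeff (pderiv (H_less h k \<theta>)) i * coeff (G_less g k) (k - i)" for i
    using assms by (auto simp: coeff_pderiv coeff_H_less coeff_G_less)
  ultimately show ?thesis
    by (simp add: Gamma_nf_def coeff_sum coeff_mult)
qed

section \<open>Coefficient comparison in the transformed equation\<close>

text \<open>Multiplying the normal form by \<open>U = 1 + pderiv H\<close> and replacing the series
  by its partial sum costs only \<open>O(\<rho> ^ Suc N)\<close>. This leaves a polynomial in
  \<open>\<rho>\<close> of that order, whose coefficient \<open>k\<close> must vanish.\<close>

lemma normal_form_has_derivative:
  assumes polar: "polar_form P Q R" and nf: "normal_form N R h g"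
    and k: "2 \<le> k" "k \<le> N" and \<theta>: "\<theta> \<in> {0..pi}"
  shows "(h k has_vector_derivative Gamma_nf R h g k \<theta> - g k) (at \<theta> within {0..pi})"
proof -
  define H where "H = H_less h (Suc N) \<theta>"
  define D where "D = (\<lambda>l \<theta>. vector_derivative (h l) (at \<theta> within {0..pi}))"
  have hD: "(h l has_vector_derivative D l \<theta>) (at \<theta> within {0..pi})" if "l \<in> {2..N}" for l
    using nf that \<theta> unfolding normal_form_def differentiable_on_def D_def
    by (blast intro: vector_derivative_works[THEN iffD1])
  have dH: "vector_derivative (\<lambda>t. poly (H_less h (Suc N) t) \<rho>) (at \<theta> within {0..pi})
      = poly (H_less D (Suc N) \<theta>) \<rho>" for \<rho>
  \<comment> \<open>\<open>vector_derivative\<close> is a choice; derivatives within a nondegenerate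
    closed interval are unique, also at its endpoints.\<close>
  proof (rule vector_derivative_within_closed_interval[OF pi_gt_zero \<theta>])
    have "((\<lambda>t. \<Sum>l\<in>{2..<Suc N}. h l t * \<rho> ^ l) has_vector_derivative
        (\<Sum>l\<in>{2..<Suc N}. D l \<theta> * \<rho> ^ l)) (at \<theta> within {0..pi})"
      by (intro has_vector_derivative_sum has_vector_derivative_mult_left hD) auto
    then show "((\<lambda>t. poly (H_less h (Suc N) t) \<rho>) has_vector_derivative
        poly (H_less D (Suc N) \<theta>) \<rho>) (at \<theta> within {0..pi})"
      by (simp add: H_less_def poly_sum poly_monom del: sum.op_ivl_Suc)
  qed
  define G where "G = G_less g (Suc N)"
  define p where "p = monom 1 1 + H"
  define U where "U = 1 + pderiv H"
  define T where "T = (\<lambda>r. \<Sum>\<^sub>\<infinity>j\<in>{2..}. R j \<theta> * r ^ j)"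
  have p0: "coeff p 0 = 0"
    by (simp add: p_def H_def coeff_H_less)
  have trans: "transformed_rhs N R h \<theta> \<rho>
      = (T (poly p \<rho>) - poly (H_less D (Suc N) \<theta>) \<rho>) / poly U \<rho>" for \<rho>
    by (simp add: transformed_rhs_def dH T_def p_def U_def H_def poly_monom)
  have G: "(\<Sum>j=2..N. g j * \<rho> ^ j) = poly G \<rho>" for \<rho>
    by (simp add: G_def G_less_def poly_sum poly_monom atLeastLessThanSuc_atLeastAtMost)
  have U: "(poly U \<longlongrightarrow> 1) (at_right 0)"
  proof -
    have "(poly U \<longlongrightarrow> poly U 0) (at_right 0)"
      by (rule tendsto_intros)+
    then show ?thesis
      by (simp add: U_def poly_0_coeff_0 coeff_pderiv H_def coeff_H_less)
  qed
  obtain C \<delta> where "\<delta> > 0" and nfC: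
      "\<And>\<rho>. \<rho> \<in> {0<..<\<delta>} \<Longrightarrow> \<bar>transformed_rhs N R h \<theta> \<rho> - poly G \<rho>\<bar> \<le> C * \<rho> ^ (N + 1)"
    using nf \<theta> unfolding normal_form_def G by blast
  have "(\<lambda>\<rho>. transformed_rhs N R h \<theta> \<rho> - poly G \<rho>) \<in> O[at_right 0](\<lambda>\<rho>. \<rho> ^ Suc N)"
  proof (rule bigoI)
    have "\<forall>\<^sub>F \<rho> in at_right 0. \<rho> \<in> {0<..<\<delta>}"
      using \<open>\<delta> > 0\<close> by (rule eventually_at_right_real)
    then show "\<forall>\<^sub>F \<rho> in at_right 0. norm (transformed_rhs N R h \<theta> \<rho> - poly G \<rho>) \<le> C * norm (\<rho> ^ Suc N)"
      by eventually_elim (use nfC in auto)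
  qed
  moreover have "poly U \<in> O[at_right 0](\<lambda>_. 1)"
    by (rule bigoI_tendsto[where c = 1]) (use U in auto)
  ultimately have "(\<lambda>\<rho>. poly U \<rho> * (transformed_rhs N R h \<theta> \<rho> - poly G \<rho>))
      \<in> O[at_right 0](\<lambda>\<rho>. 1 * \<rho> ^ Suc N)"
    by (intro landau_o.big.mult)
  moreover have "\<forall>\<^sub>F \<rho> in at_right 0. poly U \<rho> * (transformed_rhs N R h \<theta> \<rho> - poly G \<rho>)
      = T (poly p \<rho>) - poly (H_less D (Suc N) \<theta>) \<rho> - poly (U * G) \<rho>"
    \<comment> \<open>Near 0 the denominator \<open>poly U \<rho>\<close> is positive, so the
      division in \<open>transformed_rhs\<close> cancels.\<close>
    using order_tendstoD(1)[OF U zero_less_one]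
    by eventually_elim (simp add: trans field_simps)
  ultimately have 1: "(\<lambda>\<rho>. T (poly p \<rho>) - poly (H_less D (Suc N) \<theta>) \<rho> - poly (U * G) \<rho>)
      \<in> O[at_right 0](\<lambda>\<rho>. \<rho> ^ Suc N)"
    by (simp add: landau_o.big.in_cong)
  obtain s where s: "s > 0" "(\<lambda>j. R j \<theta> * s ^ j) summable_on {2..}"
  proof -
    obtain d where "d > 0" "\<forall>r\<in>{0<..<d}. (\<lambda>j. R j \<theta> * r ^ j) summable_on {2..}"
      using polar \<theta> unfolding polar_form_def by (meson has_sum_imp_summable)
    then show thesis
      by (intro that[of "d / 2"]) auto
  qed
  \<comment> \<open>The tail estimate holds for positive arguments tending to 0;
    \<open>poly p \<rho>\<close> is such an argument, being \<open>\<rho>\<close> times a factor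
    that tends to 1.\<close>
  have p_pos: "filterlim (poly p) (at_right 0) (at_right 0)"
    unfolding filterlim_at
  proof
    have "(poly p \<longlongrightarrow> poly p 0) (at_right 0)"
      by (rule tendsto_intros)+
    then show "(poly p \<longlongrightarrow> 0) (at_right 0)"
      by (simp add: poly_0_coeff_0 p0)
    have eq: "poly p x = x * poly (poly_shift 1 p) x" for x
      using poly_eq_power_mult_poly_shift[of 1 p x] p0 by simp
    have "(poly (poly_shift 1 p) \<longlongrightarrow> poly (poly_shift 1 p) 0) (at_right 0)"
      by (rule tendsto_intros)+
    then have "(poly (poly_shift 1 p) \<longlongrightarrow> 1) (at_right 0)"
      by (simp add: poly_0_coeff_0 coeff_poly_shift p_def H_def coeff_H_less)
    then have "\<forall>\<^sub>F x in at_right 0. 0 < poly (poly_shift 1 p) x"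
      by (rule order_tendstoD) simp
    then show "\<forall>\<^sub>F x in at_right 0. poly p x \<in> {0<..} \<and> poly p x \<noteq> 0"
      using eventually_at_right_less by eventually_elim (simp add: eq)
  qed
  define W where "W = (\<Sum>j=2..N. smult (R j \<theta>) (p ^ j))"
  have "(\<lambda>\<rho>. T (poly p \<rho>) - (\<Sum>j=2..N. R j \<theta> * poly p \<rho> ^ j)) \<in> O[at_right 0](\<lambda>\<rho>. poly p \<rho> ^ Suc N)"
    using landau_o.big.compose[OF power_series_tail_bigo[OF s, of N] p_pos] by (simp add: T_def)
  moreover have "(\<lambda>\<rho>. poly p \<rho> ^ Suc N) \<in> O[at_right 0](\<lambda>\<rho>. \<rho> ^ Suc N)"
    by (rule landau_o.big_power)
      (use poly_bigo_power[of 1 p] p0 in simp)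
  ultimately have "(\<lambda>\<rho>. T (poly p \<rho>) - poly W \<rho>) \<in> O[at_right 0](\<lambda>\<rho>. \<rho> ^ Suc N)"
    by (auto simp: W_def poly_sum intro: landau_o.big_trans)
  \<comment> \<open>Subtracting the two estimates removes the series \<open>T\<close>.\<close>
  from sum_in_bigo(2)[OF 1 this]
  have "poly (W - H_less D (Suc N) \<theta> - U * G) \<in> O[at_right 0](\<lambda>\<rho>. \<rho> ^ Suc N)"
    by (rule landau_o.big.in_cong[THEN iffD1, rotated]) (simp add: algebra_simps)
  from poly_bigo_at_right_0_imp_coeff_eq_0[OF this k(2)]
  have "D k \<theta> = coeff (W - pderiv H * G) k - coeff G k"
    using k by (simp add: U_def distrib_right coeff_H_less)
  also have "\<dots> = Gamma_nf R h g k \<theta> - g k"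
    using k by (simp add: Gamma_nf_eq_coeff[OF k] W_def p_def H_def G_def coeff_G_less)
  finally show ?thesis
    using hD[of k] k by simp
qed

section \<open>Identification of the transformation function\<close>

text \<open>The two sides have the same derivative on \<open>[0, pi]\<close>, so they differ by a
  constant, which is 0 by their values at 0.\<close>

lemma antiderivative_eq_alg_eval_I_op:
  assumes deriv: "\<And>\<theta>. \<theta> \<in> {0..pi} \<Longrightarrow>
      ((\<lambda>t. complex_of_real (f t)) has_vector_derivative alg_eval F (of_real \<theta>) (exp (\<i> * of_real \<theta>)))
        (at \<theta> within {0..pi})"
    and "f 0 = 0" and \<theta>: "\<theta> \<in> {0..pi}"
  shows "complex_of_real (f \<theta>) = alg_eval (I_op F) (of_real \<theta>) (exp (\<i> * of_real \<theta>))"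
proof -
  let ?E = "\<lambda>t::real. alg_eval (I_op F) (of_real t) (exp (\<i> * of_real t))"
  have "((\<lambda>t. complex_of_real (f t) - ?E t) has_vector_derivative 0) (at x within {0..pi})"
    if "x \<in> {0..pi}" for x
    using has_vector_derivative_diff[OF deriv[OF that]
        has_vector_derivative_real_field[OF has_field_derivative_alg_eval_I_op[of F]]]
    by simp
  then obtain c where c: "\<And>x. x \<in> {0..pi} \<Longrightarrow> complex_of_real (f x) - ?E x = c"
    using has_vector_derivative_zero_constant[of "{0..pi}" "\<lambda>t. complex_of_real (f t) - ?E t"] by auto
  show ?thesis
    using c[of 0] c[OF \<theta>] \<open>f 0 = 0\<close> by (simp add: alg_eval_I_op_at_0)
qed

theorem theorem15:
  fixes P Q :: "nat \<Rightarrow> nat \<Rightarrow> real \<Rightarrow> real \<Rightarrow> real"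
    and R h :: "nat \<Rightarrow> nat \<Rightarrow> real \<Rightarrow> real"
    and g :: "nat \<Rightarrow> nat \<Rightarrow> real"
    and i N k :: nat
    and Pt :: alg
  assumes "\<forall>s\<in>{1, 2}. convergent_series (P s) \<and> convergent_series (Q s)"
    and "\<forall>s\<in>{1, 2}. polar_form (P s) (Q s) (R s)"
    and "\<forall>s\<in>{1, 2}. normal_form N (R s) (h s) (g s)"
    and "i \<in> {1, 2}" and "N \<ge> 2" and "2 \<le> k" and "k \<le> N"
    and "alg_rep Pt (\<lambda>\<theta>. complex_of_real (Gamma_nf (R i) (h i) (g i) k \<theta>))"
  shows "complex_of_real (g i k) = M_op Pt
    \<and> (\<forall>F. alg_rep F (\<lambda>\<theta>. complex_of_real (h i k \<theta>))
             \<longleftrightarrow> F = I_op (Pt - alg_const (complex_of_real (g i k))))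
    \<and> (\<forall>\<theta>\<in>{0..pi}. complex_of_real (h i k \<theta>)
          = alg_eval (I_op (Pt - alg_const (complex_of_real (g i k))))
              (complex_of_real \<theta>) (exp (\<i> * complex_of_real \<theta>)))
    \<and> h i k 0 = 0 \<and> h i k pi = 0"
proof -
  define F where "F = Pt - alg_const (complex_of_real (g i k))"
  have polar: "polar_form (P i) (Q i) (R i)" and nf: "normal_form N (R i) (h i) (g i)"
    using assms(2-4) by blast+
  have h0: "h i k 0 = 0" and hpi: "h i k pi = 0"
    using nf assms(6,7) by (auto simp: normal_form_def)
  have rep: "complex_of_real (h i k \<theta>) = alg_eval (I_op F) (of_real \<theta>) (exp (\<i> * of_real \<theta>))"
    if "\<theta> \<in> {0..pi}" for \<theta>
  proof (rule antiderivative_eq_alg_eval_I_op[where f = "h i k", OF _ h0 that])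
    fix \<theta> assume \<theta>: "\<theta> \<in> {0..pi}"
    have "alg_eval F (of_real \<theta>) (exp (\<i> * of_real \<theta>))
        = complex_of_real (Gamma_nf (R i) (h i) (g i) k \<theta> - g i k)"
      using assms(8) \<theta> by (simp add: alg_rep_def F_def alg_eval_linear)
    then show "((\<lambda>t. complex_of_real (h i k t)) has_vector_derivative
        alg_eval F (of_real \<theta>) (exp (\<i> * of_real \<theta>))) (at \<theta> within {0..pi})"
      using has_vector_derivative_of_real[OF has_real_derivative_iff_has_vector_derivative[THEN iffD2,
            OF normal_form_has_derivative[OF polar nf assms(6,7) \<theta>]]]
      by simp
  qed
  then have alg: "alg_rep (I_op F) (\<lambda>\<theta>. complex_of_real (h i k \<theta>))"
    by (simp add: alg_rep_def)
  \<comment> \<open>The condition at \<open>pi\<close> determines \<open>g i k\<close>: the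
    antiderivative takes the value \<open>pi * M_op F\<close> there, and \<open>M_op\<close> fixes
    constants.\<close>
  have "complex_of_real pi * M_op F = 0"
    using rep[of pi] hpi by (simp add: alg_eval_I_op_at_pi)
  then have "complex_of_real (g i k) = M_op Pt"
    by (simp add: F_def M_op_diff_const)
  then show ?thesis
    using rep alg alg_rep_unique h0 hpi unfolding F_def by blast
qed

end
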